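(* Let $G$ be an $n$-cell weighted network and $\mathcal P$ a tagged partition of its set of cells which is not standard. The partition $\mathcal P$ is even-odd-balanced for $G$ if and only if, for every choice of total phase space $(\mathbb{R}^k)^n$ ($k\ge1$), the generalized polydiagonal $\Delta_{\mathcal P}$ is left invariant under the flow of every system in $I_{G,eo}$.
   Context: A weighted network $G$ with set of cells $C=\{1,\ldots,n\}$ is a directed graph with real edge weights. Its adjacency matrix is $W_G=[w_{ij}]\in\mathbb{R}^{n\times n}$, where $w_{ij}$ is the weight of the edge from cell $j$ to cell $i$ (zero if there is no such edge; self-loops allowed). Tagged partition: let $p,q,r$ be nonnegative integers with $0\le q\le p\le n$, $r\in\{0,1\}$. A tagged partition $\mathcal P$ of $C$ determined by $p,q,r$ is a partition of $C$ into $p+q+r$ disjoint nonempty parts: $P_1,\ldots,P_p$; $\overline P_1,\ldots,\overline P_q$, where $\overline P_l$ is called the counterpart of $P_l$ (and conversely); and, if $r=1$, a part $P_0$ called the zero part. It is standard if $q=0$ and $r=0$. With cell phase space $\mathbb{R}^k$, the generalized polydiagonal associated with $\mathcal P$ is $\Delta_{\mathcal P}=\{x\in(\mathbb{R}^k)^n: x_j=x_i$ if $j$ is in the same part as $i$; $x_j=-x_i$ if $j$ is in the counterpart of the part of $i$; $x_j=0$ if $j\in P_0\}$. A non-standard tagged partition $\mathcal P$ is even-odd-balanced if $\Delta_{\mathcal P}\subseteq\mathbb{R}^n$ (the case $k=1$) satisfies $W_G\Delta_{\mathcal P}\subseteq\Delta_{\mathcal P}$. Coupled cell systems with additive input structure: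 for $k\ge1$, $I_G$ is the set of systems $\dot x=f(x)$ on $(\mathbb{R}^k)^n$ of the form $\dot x_j=g(x_j)+\sum_{i=1}^n w_{ji}h(x_j,x_i)$, $j=1,\ldots,n$, with $g:\mathbb{R}^k\to\mathbb{R}^k$ and $h:\mathbb{R}^k\times\mathbb{R}^k\to\mathbb{R}^k$ smooth. $I_{G,eo}\subseteq I_G$ is the subset of those with $g$ odd and $h(x,y)$ even in $x$ and odd in $y$, i.e. $h(-x,y)=h(x,y)$ and $h(x,-y)=-h(x,y)$ for all $x,y$. A subspace $\Delta$ is left invariant under the flow of a system if every solution with initial condition in $\Delta$ remains in $\Delta$ on its interval of existence. *)

theory Defs
  imports "HOL-Analysis.Analysis" "HOL-Library.Function_Algebras"
begin

text \<open>
  Cells are the elements of a finite type \<open>'n\<close>, and a weighted network is given by its adjacency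
  matrix \<open>W :: real^'n^'n\<close>, where \<open>W $ i $ j\<close> is the weight of the edge from cell \<open>j\<close> to cell \<open>i\<close>.
  The dimension \<open>k\<close> of the cell phase space is quantified inside the main statement, so it cannot
  be a type: the space of real vectors with index set \<open>I\<close> is modelled by the functions vanishing
  outside \<open>I\<close>, with pointwise operations and the product topology, which induces the Euclidean
  topology when \<open>I\<close> is finite.
\<close>

definition coord_space :: "'i set \<Rightarrow> ('i \<Rightarrow> real) set" where
  "coord_space I = {x. \<forall>i. i \<notin> I \<longrightarrow> x i = 0}"

abbreviation Rn :: "nat \<Rightarrow> (nat \<Rightarrow> real) set" where
  "Rn k \<equiv> coord_space {..<k}"

text \<open>
  A function is \<open>C\<^sup>m\<close> iff all its iterated partial derivatives of order at most \<open>m\<close> exist and are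
  continuous; below, \<open>D i\<close> is the partial derivative in the direction of coordinate \<open>i\<close>.
\<close>

primrec C_diff :: "nat \<Rightarrow> 'i set \<Rightarrow> (('i \<Rightarrow> real) \<Rightarrow> real) \<Rightarrow> bool" where
  "C_diff 0 I f \<longleftrightarrow> continuous_on (coord_space I) f"
| "C_diff (Suc m) I f \<longleftrightarrow> continuous_on (coord_space I) f \<and>
     (\<exists>D. \<forall>i\<in>I. C_diff m I (D i) \<and>
        (\<forall>x\<in>coord_space I. ((\<lambda>t. f (x(i := t))) has_real_derivative D i x) (at (x i))))"

definition smooth :: "'i set \<Rightarrow> (('i \<Rightarrow> real) \<Rightarrow> real) \<Rightarrow> bool" where
  "smooth I f \<longleftrightarrow> (\<forall>m. C_diff m I f)"

definition smooth_map1 :: "nat \<Rightarrow> ((nat \<Rightarrow> real) \<Rightarrow> nat \<Rightarrow> real) \<Rightarrow> bool" where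
  "smooth_map1 k g \<longleftrightarrow> (\<forall>x\<in>Rn k. g x \<in> Rn k) \<and> (\<forall>a<k. smooth {..<k} (\<lambda>x. g x a))"

text \<open>
  A pair of vectors in \<open>Rn k\<close> is a vector indexed by the disjoint union of two copies of
  \<open>{..<k}\<close>, so that smoothness of \<open>h\<close> is joint smoothness in both arguments.
\<close>

definition smooth_map2 ::
    "nat \<Rightarrow> ((nat \<Rightarrow> real) \<Rightarrow> (nat \<Rightarrow> real) \<Rightarrow> nat \<Rightarrow> real) \<Rightarrow> bool" where
  "smooth_map2 k h \<longleftrightarrow> (\<forall>x\<in>Rn k. \<forall>y\<in>Rn k. h x y \<in> Rn k) \<and>
     (\<forall>a<k. smooth ({..<k} <+> {..<k}) (\<lambda>z. h (z \<circ> Inl) (z \<circ> Inr) a))"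

datatype part_label = Main_Part nat | Counterpart nat | Zero_Part

definition labels :: "nat \<Rightarrow> nat \<Rightarrow> nat \<Rightarrow> part_label set" where
  "labels p q r = Main_Part ` {1..p} \<union> Counterpart ` {1..q} \<union> (if r = 1 then {Zero_Part} else {})"

definition tagged_partition ::
    "nat \<Rightarrow> nat \<Rightarrow> nat \<Rightarrow> (part_label \<Rightarrow> 'n::finite set) \<Rightarrow> bool" where
  "tagged_partition p q r P \<longleftrightarrow> q \<le> p \<and> p \<le> CARD('n) \<and> r \<in> {0, 1} \<and>
     (\<forall>l\<in>labels p q r. P l \<noteq> {}) \<and>
     disjoint_family_on P (labels p q r) \<and>
     (\<Union>l\<in>labels p q r. P l) = UNIV"

definition standard :: "nat \<Rightarrow> nat \<Rightarrow> nat \<Rightarrow> bool" where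
  "standard p q r \<longleftrightarrow> q = 0 \<and> r = 0"

text \<open>
  The cell phase space is a parameter \<open>V\<close>: it is \<open>Rn k\<close> for coupled cell systems and
  \<open>UNIV :: real set\<close> for the polydiagonal in \<open>real^'n\<close> on which the adjacency matrix acts.
\<close>

definition polydiagonal ::
    "'v::{zero,uminus} set \<Rightarrow> nat \<Rightarrow> nat \<Rightarrow> nat \<Rightarrow> (part_label \<Rightarrow> 'n::finite set) \<Rightarrow> ('v^'n) set" where
  "polydiagonal V p q r P = {x. (\<forall>i. x $ i \<in> V) \<and>
     (\<forall>l\<in>labels p q r. \<forall>i\<in>P l. \<forall>j\<in>P l. x $ j = x $ i) \<and>
     (\<forall>m\<in>{1..q}. \<forall>i\<in>P (Main_Part m). \<forall>j\<in>P (Counterpart m). x $ j = - x $ i) \<and>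
     (r = 1 \<longrightarrow> (\<forall>j\<in>P Zero_Part. x $ j = 0))}"

definition even_odd_balanced ::
    "real^'n^'n \<Rightarrow> nat \<Rightarrow> nat \<Rightarrow> nat \<Rightarrow> (part_label \<Rightarrow> 'n::finite set) \<Rightarrow> bool" where
  "even_odd_balanced W p q r P \<longleftrightarrow>
     (\<lambda>x. W *v x) ` polydiagonal UNIV p q r P \<subseteq> polydiagonal UNIV p q r P"

definition additive_field ::
    "real^'n^'n \<Rightarrow> ((nat \<Rightarrow> real) \<Rightarrow> nat \<Rightarrow> real) \<Rightarrow>
     ((nat \<Rightarrow> real) \<Rightarrow> (nat \<Rightarrow> real) \<Rightarrow> nat \<Rightarrow> real) \<Rightarrow>
     (nat \<Rightarrow> real)^'n \<Rightarrow> (nat \<Rightarrow> real)^'n::finite" where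
  "additive_field W g h x =
     (\<chi> j. (\<lambda>a. g (x $ j) a + (\<Sum>i\<in>UNIV. W $ j $ i * h (x $ j) (x $ i) a)))"

definition additive_systems ::
    "nat \<Rightarrow> real^'n^'n \<Rightarrow> ((nat \<Rightarrow> real)^'n \<Rightarrow> (nat \<Rightarrow> real)^'n::finite) set" where
  "additive_systems k W = {additive_field W g h | g h. smooth_map1 k g \<and> smooth_map2 k h}"

definition even_odd_systems ::
    "nat \<Rightarrow> real^'n^'n \<Rightarrow> ((nat \<Rightarrow> real)^'n \<Rightarrow> (nat \<Rightarrow> real)^'n::finite) set" where
  "even_odd_systems k W = {additive_field W g h | g h. smooth_map1 k g \<and> smooth_map2 k h \<and>
     (\<forall>x\<in>Rn k. g (- x) = - g x) \<and>
     (\<forall>x\<in>Rn k. \<forall>y\<in>Rn k. h (- x) y = h x y \<and> h x (- y) = - h x y)}"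

lemma even_odd_systems_subset: "even_odd_systems k W \<subseteq> additive_systems k W"
  unfolding even_odd_systems_def additive_systems_def by blast

definition solution_on ::
    "nat \<Rightarrow> ((nat \<Rightarrow> real)^'n \<Rightarrow> (nat \<Rightarrow> real)^'n::finite) \<Rightarrow>
     real set \<Rightarrow> (real \<Rightarrow> (nat \<Rightarrow> real)^'n) \<Rightarrow> bool" where
  "solution_on k f T x \<longleftrightarrow> (\<forall>t\<in>T. \<forall>j. x t $ j \<in> Rn k \<and>
     (\<forall>a<k. ((\<lambda>s. (x s $ j) a) has_real_derivative (f (x t) $ j) a) (at t)))"

text \<open>
  \<open>T\<close> ranges over all open intervals around the initial time on which a solution is defined, in
  particular over maximal intervals of existence; systems are autonomous, so the initial time is \<open>0\<close>.
\<close>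

definition flow_invariant ::
    "nat \<Rightarrow> ((nat \<Rightarrow> real)^'n \<Rightarrow> (nat \<Rightarrow> real)^'n::finite) \<Rightarrow> ((nat \<Rightarrow> real)^'n) set \<Rightarrow> bool" where
  "flow_invariant k f S \<longleftrightarrow>
     (\<forall>T x. open T \<and> is_interval T \<and> 0 \<in> T \<and> solution_on k f T x \<and> x 0 \<in> S \<longrightarrow>
        (\<forall>t\<in>T. x t \<in> S))"

end

theory Submission imports Defs begin

text \<open>
  If the partition is even-odd-balanced, then oddness of \<open>h\<close> in the second argument puts
  \<open>i \<mapsto> h (x j) (x i)\<close> into the polydiagonal whenever \<open>x\<close> is there, and evenness in the first one
  makes the systems at a cell and at a cell of the counterpart agree up to sign; so every even-odd
  vector field is tangent to the polydiagonal. Invariance needs no existence theory: the defect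
  \<open>x - \<pi> x\<close> of a solution, with \<open>\<pi>\<close> a projection onto the polydiagonal, satisfies a Gronwall
  inequality because the field is Lipschitz on boxes. Conversely, \<open>g = 0\<close> and \<open>h (x, y) = y\<close> on
  one-dimensional cells give the linear system \<open>x' = W x\<close>, and differentiating a solution at time
  \<open>0\<close> shows that \<open>W\<close> preserves the polydiagonal.
\<close>

section \<open>Analytic tools: Lipschitz bounds on boxes and a Gronwall inequality\<close>

text \<open>Tychonoff: the box is a product of compact sets. The factor
  \<open>{0} \<inter> {-R..R}\<close> off \<open>I\<close> keeps this true for negative
  \<open>R\<close>, where the box is empty.\<close>

lemma compact_coord_box:
  "compact {x \<in> coord_space I. \<forall>i. \<bar>x i\<bar> \<le> (R::real)}"
proof -
  let ?S = "\<lambda>i. if i \<in> I then {-R..R} else ({0} \<inter> {-R..R})"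
  have "x i \<in> ?S i \<longleftrightarrow> (i \<notin> I \<longrightarrow> x i = 0) \<and> \<bar>x i\<bar> \<le> R" for x :: "'a \<Rightarrow> real" and i
    by (cases "i \<in> I") (simp_all add: abs_le_iff minus_le_iff, auto)
  then have "{x \<in> coord_space I. \<forall>i. \<bar>x i\<bar> \<le> R} = PiE UNIV ?S"
    unfolding coord_space_def PiE_UNIV_domain Pi_def by blast
  moreover have "compactin (product_topology (\<lambda>_. euclidean) UNIV) (PiE UNIV ?S)"
    by (subst compactin_PiE) (simp add: compact_Int)
  ultimately show ?thesis
    by (simp add: euclidean_product_topology)
qed

text \<open>Pass from \<open>x\<close> to \<open>y\<close> one coordinate at a time. Each move stays
  in the box, so the one-variable mean value inequality applies, with a bound on the partial
  derivative that compactness of the box provides.\<close>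

lemma C1_lipschitz_on_box:
  assumes fin: "finite I" and f: "C_diff 1 I f"
  shows "\<exists>L\<ge>0. \<forall>x\<in>coord_space I. \<forall>y\<in>coord_space I.
    (\<forall>i. \<bar>x i\<bar> \<le> R) \<longrightarrow> (\<forall>i. \<bar>y i\<bar> \<le> R) \<longrightarrow> \<bar>f x - f y\<bar> \<le> L * (\<Sum>i\<in>I. \<bar>x i - y i\<bar>)"
proof -
  define B where "B = {x \<in> coord_space I. \<forall>i. \<bar>x i\<bar> \<le> R}"
  obtain D where D: "\<And>i. i \<in> I \<Longrightarrow> continuous_on (coord_space I) (D i)"
      "\<And>i x. i \<in> I \<Longrightarrow> x \<in> coord_space I \<Longrightarrow>
        ((\<lambda>t. f (x(i := t))) has_real_derivative D i x) (at (x i))"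
    using f by auto
  have "\<exists>M. \<forall>x\<in>B. \<bar>D i x\<bar> \<le> M" if "i \<in> I" for i
  proof -
    have "continuous_on B (D i)"
      using D(1)[OF that] by (rule continuous_on_subset) (auto simp: B_def)
    then have "compact (D i ` B)"
      using compact_coord_box[of I R] by (auto simp: B_def intro: compact_continuous_image)
    then show ?thesis
      using compact_imp_bounded by (fastforce simp: bounded_real)
  qed
  then obtain M where M: "\<And>i x. i \<in> I \<Longrightarrow> x \<in> B \<Longrightarrow> \<bar>D i x\<bar> \<le> M i"
    by metis
  \<comment> \<open>A single bound for all partial derivatives; a sum of absolute values, unlike a
    maximum, also makes sense for empty \<open>I\<close>.\<close>
  define L where "L = (\<Sum>i\<in>I. \<bar>M i\<bar>)"
  have M_L: "\<bar>D i x\<bar> \<le> L" if "i \<in> I" "x \<in> B" for i x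
    using M[OF that] member_le_sum[of i I "\<lambda>i. \<bar>M i\<bar>"] that fin by (auto simp: L_def)
  \<comment> \<open>Induction on a set \<open>J\<close> containing all coordinates where
    \<open>x\<close> and \<open>y\<close> differ. \<open>x\<close> is generalised because the
    induction hypothesis is applied to \<open>x(i := y i)\<close>.\<close>
  have step: "\<bar>f x - f y\<bar> \<le> L * (\<Sum>i\<in>J. \<bar>x i - y i\<bar>)"
    if "finite J" "J \<subseteq> I" "x \<in> B" "y \<in> B" "\<And>i. i \<notin> J \<Longrightarrow> x i = y i" for J x y
    using that
  proof (induction J arbitrary: x rule: finite_induct)
    case empty
    then have "x = y" by auto
    then show ?case by simp
  next
    case (insert i J)
    let ?x = "x(i := y i)"
    have x': "x(i := t) \<in> B" if "\<bar>t\<bar> \<le> R" for t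
      using insert.prems that by (auto simp: B_def coord_space_def)
    have ti: "\<bar>t\<bar> \<le> R" if "t \<in> {-R..R}" for t
      using that by auto
    have "\<bar>f (x(i := x i)) - f (x(i := y i))\<bar> \<le> L * \<bar>x i - y i\<bar>"
    proof (rule field_differentiable_bound[where S = "{-R..R}" and f = "\<lambda>t. f (x(i := t))"
          and f' = "\<lambda>t. D i (x(i := t))" and B = L, unfolded real_norm_def])
      fix t assume "t \<in> {-R..R}"
      then have t: "x(i := t) \<in> B" using x' ti by blast
      then show "((\<lambda>t. f (x(i := t))) has_real_derivative D i (x(i := t))) (at t within {-R..R})"
        using D(2)[of i "x(i := t)"] insert.prems
        by (auto simp: B_def intro: has_field_derivative_at_within)
      show "\<bar>D i (x(i := t))\<bar> \<le> L"
        using M_L t insert.prems by blast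
    qed (use insert.prems in \<open>auto simp: B_def abs_le_iff minus_le_iff\<close>)
    moreover have "\<bar>f ?x - f y\<bar> \<le> L * (\<Sum>j\<in>J. \<bar>?x j - y j\<bar>)"
      using insert.prems by (intro insert.IH x') (auto simp: B_def)
    moreover have "(\<Sum>j\<in>J. \<bar>?x j - y j\<bar>) = (\<Sum>j\<in>J. \<bar>x j - y j\<bar>)"
      using insert.hyps by (intro sum.cong) auto
    ultimately show ?case
      using insert.hyps by (simp add: distrib_left)
  qed
  show ?thesis
  proof (intro exI conjI ballI impI)
    show "L \<ge> 0" by (simp add: L_def sum_nonneg)
    fix x y assume "x \<in> coord_space I" "y \<in> coord_space I" "\<forall>i. \<bar>x i\<bar> \<le> R" "\<forall>i. \<bar>y i\<bar> \<le> R"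
    then show "\<bar>f x - f y\<bar> \<le> L * (\<Sum>i\<in>I. \<bar>x i - y i\<bar>)"
      using fin by (intro step) (auto simp: B_def coord_space_def)
  qed
qed

text \<open>With an integrating factor, \<open>E s * exp (- C * s)\<close> is nonincreasing for
  \<open>t \<ge> 0\<close> and \<open>E s * exp (C * s)\<close> is nondecreasing for
  \<open>t \<le> 0\<close>; both vanish at \<open>0\<close>. The bound on the absolute value of
  \<open>E' s\<close> is what covers backward time too. For a nonnegative \<open>E\<close> the
  conclusion means \<open>E t = 0\<close>.\<close>

lemma gronwall_zero:
  fixes E :: "real \<Rightarrow> real"
  assumes deriv: "\<And>s. s \<in> closed_segment 0 t \<Longrightarrow> (E has_real_derivative E' s) (at s)"
    and bound: "\<And>s. s \<in> closed_segment 0 t \<Longrightarrow> \<bar>E' s\<bar> \<le> C * E s"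
    and "E 0 = 0"
  shows "E t \<le> 0"
proof (cases "0 \<le> t")
  case True
  have "E 0 * exp (- C * 0) \<ge> E t * exp (- C * t)"
  proof (rule DERIV_nonpos_imp_nonincreasing[OF True, where f = "\<lambda>s. E s * exp (- C * s)"])
    fix s assume s: "0 \<le> s" "s \<le> t"
    then have s': "s \<in> closed_segment 0 t" by (simp add: closed_segment_eq_real_ivl)
    have "((\<lambda>s. E s * exp (- C * s)) has_real_derivative (E' s - C * E s) * exp (- C * s)) (at s)"
      using DERIV_mult[OF deriv[OF s'] DERIV_fun_exp[OF DERIV_cmult_Id[of "- C"]]]
      by (simp add: algebra_simps)
    moreover have "(E' s - C * E s) * exp (- C * s) \<le> 0"
      using bound[OF s'] by (intro mult_nonpos_nonneg) auto
    ultimately show "\<exists>y. ((\<lambda>s. E s * exp (- C * s)) has_real_derivative y) (at s) \<and> y \<le> 0"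
      by blast
  qed
  then show ?thesis using \<open>E 0 = 0\<close> by (simp add: mult_le_0_iff)
next
  case False
  then have t: "t \<le> 0" by simp
  have "E t * exp (C * t) \<le> E 0 * exp (C * 0)"
  proof (rule DERIV_nonneg_imp_nondecreasing[OF t, where f = "\<lambda>s. E s * exp (C * s)"])
    fix s assume s: "t \<le> s" "s \<le> 0"
    then have s': "s \<in> closed_segment 0 t" by (simp add: closed_segment_eq_real_ivl)
    have "((\<lambda>s. E s * exp (C * s)) has_real_derivative (E' s + C * E s) * exp (C * s)) (at s)"
      using DERIV_mult[OF deriv[OF s'] DERIV_fun_exp[OF DERIV_cmult_Id[of "C"]]]
      by (simp add: algebra_simps)
    moreover have "(E' s + C * E s) * exp (C * s) \<ge> 0"
      using bound[OF s'] by (intro mult_nonneg_nonneg) auto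
    ultimately show "\<exists>y. ((\<lambda>s. E s * exp (C * s)) has_real_derivative y) (at s) \<and> y \<ge> 0"
      by blast
  qed
  then show ?thesis using \<open>E 0 = 0\<close> by (simp add: mult_le_0_iff)
qed

section \<open>The polydiagonal as the fixed space of a sign projection\<close>

text \<open>
  Every cell \<open>j\<close> gets a sign \<open>s j\<close> and a representative \<open>\<rho> j\<close>, chosen in a main part when the sign
  is nonzero, so that \<open>x \<mapsto> (\<lambda>j. s j * x (\<rho> j))\<close> is a projection onto the polydiagonal.
\<close>

lemma polydiagonal_sign_form:
  fixes P :: "part_label \<Rightarrow> 'n::finite set"
  assumes "tagged_partition p q r P"
  obtains s :: "'n \<Rightarrow> real" and \<rho> :: "'n \<Rightarrow> 'n"
  where "\<And>j. s j \<in> {-1, 0, 1}" "\<And>j. s j \<noteq> 0 \<Longrightarrow> s (\<rho> j) = 1 \<and> \<rho> (\<rho> j) = \<rho> j"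
    "\<And>x :: real^'n. x \<in> polydiagonal UNIV p q r P \<longleftrightarrow> (\<forall>j. x $ j = s j * x $ \<rho> j)"
proof -
  note tp = assms[unfolded tagged_partition_def]
  have "\<forall>j. \<exists>l\<in>labels p q r. j \<in> P l" using tp by blast
  then obtain lab where lab: "\<And>j. lab j \<in> labels p q r" "\<And>j. j \<in> P (lab j)" by metis
  have labI: "lab j = l" if "l \<in> labels p q r" "j \<in> P l" for j l
    using that lab[of j] tp unfolding disjoint_family_on_def by blast
  have "\<forall>m\<in>{1..p}. \<exists>i. i \<in> P (Main_Part m)" using tp by (auto simp: labels_def)
  then obtain e where e: "\<And>m. m \<in> {1..p} \<Longrightarrow> e m \<in> P (Main_Part m)" by metis
  have labe: "lab (e m) = Main_Part m" if "m \<in> {1..p}" for m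
    using that by (intro labI e) (auto simp: labels_def)
  have qp: "q \<le> p" and r: "r = 0 \<or> r = 1" using tp by auto
  \<comment> \<open>A counterpart shares the representative \<open>e m\<close> of its main part,
    which exists because \<open>q \<le> p\<close>. On the zero part the value of
    \<open>\<rho>\<close> is a dummy, since it is multiplied by \<open>s j = 0\<close>.\<close>
  define s :: "'n \<Rightarrow> real" where
    "s j = (case lab j of Main_Part m \<Rightarrow> 1 | Counterpart m \<Rightarrow> -1 | Zero_Part \<Rightarrow> 0)" for j
  define \<rho> where
    "\<rho> j = (case lab j of Main_Part m \<Rightarrow> e m | Counterpart m \<Rightarrow> e m | Zero_Part \<Rightarrow> j)" for j
  have cases: "(\<exists>m\<in>{1..p}. lab j = Main_Part m) \<or> (\<exists>m\<in>{1..q}. lab j = Counterpart m) \<or>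
      (lab j = Zero_Part \<and> r = 1)" for j
    using lab(1)[of j] by (auto simp: labels_def split: if_splits)
  show thesis
  proof (rule that)
    show "s j \<in> {-1, 0, 1}" for j by (auto simp: s_def split: part_label.split)
    show "s (\<rho> j) = 1 \<and> \<rho> (\<rho> j) = \<rho> j" if "s j \<noteq> 0" for j
      using cases[of j] that labe qp by (auto simp: s_def \<rho>_def)
    show "x \<in> polydiagonal UNIV p q r P \<longleftrightarrow> (\<forall>j. x $ j = s j * x $ \<rho> j)" for x :: "real^'n"
    proof
      assume "x \<in> polydiagonal UNIV p q r P"
      then have same: "\<And>l i j. l \<in> labels p q r \<Longrightarrow> i \<in> P l \<Longrightarrow> j \<in> P l \<Longrightarrow> x $ j = x $ i"
        and opp: "\<And>m i j. m \<in> {1..q} \<Longrightarrow> i \<in> P (Main_Part m) \<Longrightarrow> j \<in> P (Counterpart m) \<Longrightarrow>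
          x $ j = - x $ i"
        and zero: "\<And>j. r = 1 \<Longrightarrow> j \<in> P Zero_Part \<Longrightarrow> x $ j = 0"
        unfolding polydiagonal_def by blast+
      show "\<forall>j. x $ j = s j * x $ \<rho> j"
      proof
        fix j
        consider m where "m \<in> {1..p}" "lab j = Main_Part m"
          | m where "m \<in> {1..q}" "lab j = Counterpart m" | "lab j = Zero_Part" "r = 1"
          using cases by blast
        then show "x $ j = s j * x $ \<rho> j"
        proof cases
          case 1
          then have "x $ j = x $ e m"
            using same[OF lab(1)] lab[of j] e[of m] by metis
          then show ?thesis using 1 by (simp add: s_def \<rho>_def)
        next
          case 2
          then have "x $ j = - x $ e m"
            using opp[of m "e m" j] lab(2)[of j] e[of m] qp by simp
          then show ?thesis using 2 by (simp add: s_def \<rho>_def)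
        next
          case 3
          then show ?thesis
            using zero[of j] lab(2)[of j] by (simp add: s_def)
        qed
      qed
    next
      assume x: "\<forall>j. x $ j = s j * x $ \<rho> j"
      have "x $ j = x $ i" if "l \<in> labels p q r" "i \<in> P l" "j \<in> P l" for i j l
      proof (cases l)
        case Zero_Part
        then show ?thesis
          using labI[OF that(1,2)] labI[OF that(1,3)] x[rule_format, of i] x[rule_format, of j]
          by (simp add: s_def)
      qed (use labI[OF that(1,2)] labI[OF that(1,3)] x[rule_format, of i] x[rule_format, of j]
          in \<open>simp_all add: s_def \<rho>_def\<close>)
      moreover have "x $ j = - x $ i"
        if "m \<in> {1..q}" "i \<in> P (Main_Part m)" "j \<in> P (Counterpart m)" for i j m
      proof -
        have "lab i = Main_Part m" "lab j = Counterpart m"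
          using that qp by (auto intro!: labI simp: labels_def)
        then show ?thesis
          using x[rule_format, of i] x[rule_format, of j] by (simp add: s_def \<rho>_def)
      qed
      moreover have "x $ j = 0" if "r = 1" "j \<in> P Zero_Part" for j
      proof -
        have "lab j = Zero_Part" using that by (auto intro!: labI simp: labels_def)
        then show ?thesis using x[rule_format, of j] by (simp add: s_def)
      qed
      ultimately show "x \<in> polydiagonal UNIV p q r P"
        unfolding polydiagonal_def by blast
    qed
  qed
qed

text \<open>The defining equations relate equal coordinates of different cells, so each coordinate
  can be treated separately. This transfers the sign form from real vectors to every
  \<open>k\<close>.\<close>

lemma polydiagonal_componentwise:
  "x \<in> polydiagonal V p q r P \<longleftrightarrow>
    (\<forall>j. x $ j \<in> V) \<and> (\<forall>a. (\<chi> j. (x $ j) a) \<in> polydiagonal (UNIV :: real set) p q r P)"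
  for x :: "('a \<Rightarrow> real)^'n::finite"
  unfolding polydiagonal_def mem_Collect_eq fun_eq_iff vec_lambda_beta uminus_apply zero_fun_apply
  by blast

section \<open>Flow invariance from tangency\<close>

text \<open>Smoothness of \<open>g\<close> and \<open>h\<close> enters the invariance argument
  through this estimate. Distances are summed over all cells and coordinates, the form in which the
  defect of a solution is measured later.\<close>

lemma additive_field_lipschitz_on_box:
  fixes W :: "real^'n^'n::finite"
  assumes g: "smooth_map1 k g" and h: "smooth_map2 k h" and a: "a < k"
  shows "\<exists>L. \<forall>x y. (\<forall>i. x $ i \<in> Rn k \<and> y $ i \<in> Rn k) \<longrightarrow>
    (\<forall>i b. \<bar>(x $ i) b\<bar> \<le> R \<and> \<bar>(y $ i) b\<bar> \<le> R) \<longrightarrow>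
    \<bar>(additive_field W g h x $ j) a - (additive_field W g h y $ j) a\<bar>
      \<le> L * (\<Sum>(i, b)\<in>UNIV \<times> {..<k}. \<bar>(x $ i) b - (y $ i) b\<bar>)"
proof -
  have "C_diff 1 {..<k} (\<lambda>x. g x a)"
    using g a unfolding smooth_map1_def smooth_def by blast
  from C1_lipschitz_on_box[OF _ this, of R]
  obtain G where "G \<ge> 0" and G: "\<And>u v. u \<in> Rn k \<Longrightarrow> v \<in> Rn k \<Longrightarrow> (\<And>i. \<bar>u i\<bar> \<le> R) \<Longrightarrow>
      (\<And>i. \<bar>v i\<bar> \<le> R) \<Longrightarrow> \<bar>g u a - g v a\<bar> \<le> G * (\<Sum>b<k. \<bar>u b - v b\<bar>)"
    by (auto simp: lessThan_def)
  have "C_diff 1 ({..<k} <+> {..<k}) (\<lambda>z. h (z \<circ> Inl) (z \<circ> Inr) a)"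
    using h a unfolding smooth_map2_def smooth_def by blast
  from C1_lipschitz_on_box[OF _ this, of R]
  obtain H where "H \<ge> 0" and H0: "\<And>u v. u \<in> coord_space ({..<k} <+> {..<k}) \<Longrightarrow>
      v \<in> coord_space ({..<k} <+> {..<k}) \<Longrightarrow> (\<And>i. \<bar>u i\<bar> \<le> R) \<Longrightarrow> (\<And>i. \<bar>v i\<bar> \<le> R) \<Longrightarrow>
      \<bar>h (u \<circ> Inl) (u \<circ> Inr) a - h (v \<circ> Inl) (v \<circ> Inr) a\<bar>
        \<le> H * (\<Sum>i\<in>{..<k} <+> {..<k}. \<bar>u i - v i\<bar>)"
    by auto
  \<comment> \<open>\<open>case_sum u u'\<close> glues two arguments into one vector on the disjoint
    union, where joint smoothness of \<open>h\<close> is stated; the sum of coordinate differences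
    then splits into two.\<close>
  have H: "\<bar>h u u' a - h v v' a\<bar> \<le> H * ((\<Sum>b<k. \<bar>u b - v b\<bar>) + (\<Sum>b<k. \<bar>u' b - v' b\<bar>))"
    if "u \<in> Rn k" "u' \<in> Rn k" "v \<in> Rn k" "v' \<in> Rn k"
      "\<And>i. \<bar>u i\<bar> \<le> R" "\<And>i. \<bar>u' i\<bar> \<le> R" "\<And>i. \<bar>v i\<bar> \<le> R" "\<And>i. \<bar>v' i\<bar> \<le> R" for u u' v v'
  proof -
    have cs: "case_sum u u' \<in> coord_space ({..<k} <+> {..<k})"
      if "u \<in> Rn k" "u' \<in> Rn k" for u u' :: "nat \<Rightarrow> real"
      using that by (auto simp: coord_space_def split: sum.split)
    have "\<bar>case_sum u u' i\<bar> \<le> R" "\<bar>case_sum v v' i\<bar> \<le> R" for i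
      using that by (auto split: sum.split)
    from H0[OF cs cs this] that show ?thesis
      by (simp add: case_sum_o_inj sum.Plus)
  qed
  show ?thesis
  proof (intro exI allI impI)
    fix x y :: "(nat \<Rightarrow> real)^'n"
    assume xy: "\<forall>i. x $ i \<in> Rn k \<and> y $ i \<in> Rn k"
      and R: "\<forall>i b. \<bar>(x $ i) b\<bar> \<le> R \<and> \<bar>(y $ i) b\<bar> \<le> R"
    \<comment> \<open>The total distance \<open>D\<close> dominates the distance at each single
      cell, so every term below is bounded by a multiple of \<open>D\<close>; \<open>h\<close>
      contributes \<open>D + D\<close>, one for each argument.\<close>
    define D where "D = (\<Sum>(i, b)\<in>UNIV \<times> {..<k}. \<bar>(x $ i) b - (y $ i) b\<bar>)"
    have D: "(\<Sum>b<k. \<bar>(x $ i) b - (y $ i) b\<bar>) \<le> D" for i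
      unfolding D_def sum.cartesian_product[symmetric]
      by (rule member_le_sum) (auto intro: sum_nonneg)
    have gD: "\<bar>g (x $ j) a - g (y $ j) a\<bar> \<le> G * D"
      using G[of "x $ j" "y $ j"] xy R mult_left_mono[OF D \<open>G \<ge> 0\<close>, of j] by fastforce
    have hD: "\<bar>h (x $ j) (x $ i) a - h (y $ j) (y $ i) a\<bar> \<le> H * (D + D)" for i
    proof -
      have "\<bar>h (x $ j) (x $ i) a - h (y $ j) (y $ i) a\<bar> \<le>
          H * ((\<Sum>b<k. \<bar>(x $ j) b - (y $ j) b\<bar>) + (\<Sum>b<k. \<bar>(x $ i) b - (y $ i) b\<bar>))"
        using xy R by (intro H) auto
      also have "\<dots> \<le> H * (D + D)"
        by (intro mult_left_mono add_mono D \<open>H \<ge> 0\<close>)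
      finally show ?thesis .
    qed
    have "(additive_field W g h x $ j) a - (additive_field W g h y $ j) a =
        (g (x $ j) a - g (y $ j) a) +
        (\<Sum>i\<in>UNIV. W $ j $ i * (h (x $ j) (x $ i) a - h (y $ j) (y $ i) a))"
      by (simp add: additive_field_def right_diff_distrib sum_subtractf)
    also have "\<bar>\<dots>\<bar> \<le> \<bar>g (x $ j) a - g (y $ j) a\<bar> +
        (\<Sum>i\<in>UNIV. \<bar>W $ j $ i * (h (x $ j) (x $ i) a - h (y $ j) (y $ i) a)\<bar>)"
      by (rule order_trans[OF abs_triangle_ineq add_left_mono[OF sum_abs]])
    also have "\<dots> \<le> G * D + (\<Sum>i\<in>UNIV. \<bar>W $ j $ i\<bar> * (H * (D + D)))"
      unfolding abs_mult by (intro add_mono sum_mono mult_left_mono gD hD) auto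
    also have "\<dots> = (G + (\<Sum>i\<in>UNIV. \<bar>W $ j $ i\<bar>) * (2 * H)) * D"
      by (simp add: sum_distrib_left sum_distrib_right algebra_simps)
    finally show "\<bar>(additive_field W g h x $ j) a - (additive_field W g h y $ j) a\<bar> \<le>
        (G + (\<Sum>i\<in>UNIV. \<bar>W $ j $ i\<bar>) * (2 * H)) *
          (\<Sum>(i, b)\<in>UNIV \<times> {..<k}. \<bar>(x $ i) b - (y $ i) b\<bar>)"
      by (simp add: D_def)
  qed
qed

text \<open>Let \<open>z\<close> be the projection of \<open>x u\<close>. Tangency at
  \<open>z\<close> allows \<open>f z\<close> to be subtracted from \<open>f (x u)\<close> inside the
  derivative of the defect without changing it, so the Lipschitz bound controls that derivative by
  the defect itself. The sum of squared defects is differentiable, and Gronwall forces it to stay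
  zero.\<close>

lemma flow_invariant_if_tangent:
  fixes f :: "(nat \<Rightarrow> real)^'n \<Rightarrow> (nat \<Rightarrow> real)^'n::finite" and s :: "'n \<Rightarrow> real"
  assumes s: "\<And>j. s j \<in> {-1, 0, 1}" "\<And>j. s j \<noteq> 0 \<Longrightarrow> s (\<rho> j) = 1 \<and> \<rho> (\<rho> j) = \<rho> j"
    and lip: "\<And>R j a. a < k \<Longrightarrow> \<exists>L. \<forall>x y. (\<forall>i. x $ i \<in> Rn k \<and> y $ i \<in> Rn k) \<longrightarrow>
      (\<forall>i b. \<bar>(x $ i) b\<bar> \<le> R \<and> \<bar>(y $ i) b\<bar> \<le> R) \<longrightarrow>
      \<bar>(f x $ j) a - (f y $ j) a\<bar> \<le> L * (\<Sum>(i, b)\<in>UNIV \<times> {..<k}. \<bar>(x $ i) b - (y $ i) b\<bar>)"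
    and tangent: "\<And>x j a. (\<And>i. x $ i \<in> Rn k) \<Longrightarrow> (\<And>i b. (x $ i) b = s i * (x $ \<rho> i) b) \<Longrightarrow>
      a < k \<Longrightarrow> (f x $ j) a = s j * (f x $ \<rho> j) a"
  shows "flow_invariant k f {x. (\<forall>j. x $ j \<in> Rn k) \<and> (\<forall>j a. (x $ j) a = s j * (x $ \<rho> j) a)}"
  unfolding flow_invariant_def
proof (intro allI impI ballI)
  fix T :: "real set" and x :: "real \<Rightarrow> (nat \<Rightarrow> real)^'n" and t :: real
  assume hyp: "open T \<and> is_interval T \<and> 0 \<in> T \<and> solution_on k f T x \<and>
      x 0 \<in> {x. (\<forall>j. x $ j \<in> Rn k) \<and> (\<forall>j a. (x $ j) a = s j * (x $ \<rho> j) a)}" and "t \<in> T"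
  let ?A = "(UNIV :: 'n set) \<times> {..<k}" and ?S = "closed_segment 0 t"
  have ST: "?S \<subseteq> T"
    using hyp \<open>t \<in> T\<close> by (simp add: closed_segment_subset is_interval_convex)
  have Rn: "x u $ j \<in> Rn k" if "u \<in> T" for u j
    using hyp that unfolding solution_on_def by blast
  have deriv: "((\<lambda>v. (x v $ j) a) has_real_derivative (f (x u) $ j) a) (at u)"
    if "u \<in> T" "a < k" for u j a
    using hyp that unfolding solution_on_def by blast
  have s1: "\<bar>s j\<bar> \<le> 1" for j using s(1)[of j] by auto
  \<comment> \<open>Lipschitz constants exist only on boxes: by compactness, one box contains the
    solution on the whole segment from \<open>0\<close> to \<open>t\<close>.\<close>
  obtain R where R: "\<And>u j a. u \<in> ?S \<Longrightarrow> \<bar>(x u $ j) a\<bar> \<le> R"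
  proof -
    let ?m = "\<lambda>u. \<Sum>(i, b)\<in>?A. \<bar>(x u $ i) b\<bar>"
    have "continuous_on ?S (\<lambda>u. (x u $ i) b)" if "b < k" for i b
      using deriv[OF _ that] ST
      by (intro continuous_at_imp_continuous_on ballI DERIV_isCont) blast
    then have "continuous_on ?S ?m"
      unfolding case_prod_unfold by (intro continuous_on_sum continuous_on_rabs) auto
    then have "bounded (?m ` ?S)"
      by (intro compact_imp_bounded compact_continuous_image) auto
    then obtain R where R: "\<And>u. u \<in> ?S \<Longrightarrow> \<bar>?m u\<bar> \<le> R"
      unfolding bounded_real by blast
    have "\<bar>(x u $ j) a\<bar> \<le> R" if u: "u \<in> ?S" for u j a
    proof (cases "a < k")
      case True
      then have "\<bar>(x u $ j) a\<bar> \<le> ?m u"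
        using member_le_sum[of "(j, a)" ?A "\<lambda>(i, b). \<bar>(x u $ i) b\<bar>"] by auto
      then show ?thesis using R[OF u] by linarith
    next
      case False
      then have "(x u $ j) a = 0" using Rn[of u j] u ST by (auto simp: coord_space_def)
      then show ?thesis using R[OF u] by linarith
    qed
    then show ?thesis using that by blast
  qed
  \<comment> \<open>The constants given by \<open>lip\<close> depend on the cell and the coordinate;
    the sum of their absolute values serves for all of them.\<close>
  obtain L where L: "\<And>j a y z. a < k \<Longrightarrow> (\<And>i. y $ i \<in> Rn k) \<Longrightarrow> (\<And>i. z $ i \<in> Rn k) \<Longrightarrow>
      (\<And>i b. \<bar>(y $ i) b\<bar> \<le> R) \<Longrightarrow> (\<And>i b. \<bar>(z $ i) b\<bar> \<le> R) \<Longrightarrow>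
      \<bar>(f y $ j) a - (f z $ j) a\<bar> \<le> L * (\<Sum>(i, b)\<in>?A. \<bar>(y $ i) b - (z $ i) b\<bar>)"
  proof -
    define Q where "Q j a L \<longleftrightarrow> (\<forall>x y. (\<forall>i. x $ i \<in> Rn k \<and> y $ i \<in> Rn k) \<longrightarrow>
      (\<forall>i b. \<bar>(x $ i) b\<bar> \<le> R \<and> \<bar>(y $ i) b\<bar> \<le> R) \<longrightarrow>
      \<bar>(f x $ j) a - (f y $ j) a\<bar> \<le> L * (\<Sum>(i, b)\<in>?A. \<bar>(x $ i) b - (y $ i) b\<bar>))" for j a L
    have "\<forall>j a. \<exists>L. a < k \<longrightarrow> Q j a L"
      using lip unfolding Q_def by blast
    then obtain M where M: "\<And>j a. a < k \<Longrightarrow> Q j a (M j a)"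
      by metis
    have "M j a \<le> (\<Sum>(i, b)\<in>?A. \<bar>M i b\<bar>)" if "a < k" for j a
      using member_le_sum[of "(j, a)" ?A "\<lambda>(i, b). \<bar>M i b\<bar>"] that by auto
    then have "M j a * (\<Sum>(i, b)\<in>?A. \<bar>(y $ i) b - (z $ i) b\<bar>) \<le>
        (\<Sum>(i, b)\<in>?A. \<bar>M i b\<bar>) * (\<Sum>(i, b)\<in>?A. \<bar>(y $ i) b - (z $ i) b\<bar>)" if "a < k"
      for j a and y z :: "(nat \<Rightarrow> real)^'n"
      using that by (intro mult_right_mono) (auto intro: sum_nonneg)
    with M show ?thesis
      unfolding Q_def by (intro that[of "\<Sum>(i, b)\<in>?A. \<bar>M i b\<bar>"]) (blast intro: order_trans)
  qed
  \<comment> \<open>\<open>e\<close> is the defect, \<open>e'\<close> its derivative along the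
    solution, and \<open>E\<close> the squared Euclidean size of the defect.\<close>
  define e where "e j a u = (x u $ j) a - s j * (x u $ \<rho> j) a" for j a u
  define e' where "e' j a u = (f (x u) $ j) a - s j * (f (x u) $ \<rho> j) a" for j a u
  define E where "E u = (\<Sum>(j, a)\<in>?A. (e j a u)\<^sup>2)" for u
  define E' where "E' u = (\<Sum>(j, a)\<in>?A. 2 * e j a u * e' j a u)" for u
  have de: "(e j a has_real_derivative e' j a u) (at u)" if "u \<in> T" "a < k" for j a u
    unfolding e_def e'_def by (intro DERIV_diff DERIV_cmult deriv that)
  have dE: "(E has_real_derivative E' u) (at u)" if "u \<in> T" for u
    unfolding E_def E'_def case_prod_unfold
    by (rule DERIV_sum) (use DERIV_power[OF de[OF that], where n = 2] in \<open>auto simp: mult_ac\<close>)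
  have e'_le: "\<bar>e' j a u\<bar> \<le> 2 * (L * (\<Sum>(i, b)\<in>?A. \<bar>e i b u\<bar>))" if u: "u \<in> ?S" and a: "a < k" for j a u
  proof -
    \<comment> \<open>The projection of \<open>x u\<close>. It stays in the same box because the
      signs have modulus at most \<open>1\<close>, and it is fixed by the projection because
      \<open>s (\<rho> i) = 1\<close> and \<open>\<rho> (\<rho> i) = \<rho> i\<close> whenever
      \<open>s i\<close> is nonzero.\<close>
    define z :: "(nat \<Rightarrow> real)^'n" where "z = (\<chi> i. (\<lambda>b. s i * (x u $ \<rho> i) b))"
    have zRn: "z $ i \<in> Rn k" for i
      using Rn[of u "\<rho> i"] u ST by (auto simp: z_def coord_space_def)
    have zR: "\<bar>(z $ i) b\<bar> \<le> R" for i b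
      using mult_mono[OF s1[of i] R[OF u, of "\<rho> i" b]] by (simp add: z_def abs_mult)
    have z: "(z $ i) b = s i * (z $ \<rho> i) b" for i b
      using s(2)[of i] by (cases "s i = 0") (simp_all add: z_def)
    have l: "\<bar>(f (x u) $ i) a - (f z $ i) a\<bar> \<le> L * (\<Sum>(i, b)\<in>?A. \<bar>e i b u\<bar>)" for i
    proof -
      have "u \<in> T" using u ST by blast
      from L[where j = i, OF a Rn[OF this] zRn R[OF u] zR] show ?thesis
        by (simp add: z_def e_def)
    qed
    have "e' j a u = ((f (x u) $ j) a - (f z $ j) a) - s j * ((f (x u) $ \<rho> j) a - (f z $ \<rho> j) a)"
      using tangent[OF zRn z a, of j] by (simp add: e'_def right_diff_distrib)
    also have "\<bar>\<dots>\<bar> \<le> \<bar>(f (x u) $ j) a - (f z $ j) a\<bar> + 1 * \<bar>(f (x u) $ \<rho> j) a - (f z $ \<rho> j) a\<bar>"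
      by (rule order_trans[OF abs_triangle_ineq4 add_left_mono])
        (unfold abs_mult, intro mult_right_mono s1, simp)
    also have "\<dots> \<le> L * (\<Sum>(i, b)\<in>?A. \<bar>e i b u\<bar>) + L * (\<Sum>(i, b)\<in>?A. \<bar>e i b u\<bar>)"
      using add_mono[OF l[of j] l[of "\<rho> j"]] by simp
    finally show ?thesis by simp
  qed
  have "E t \<le> 0"
  \<comment> \<open>The constant: each term of \<open>E'\<close> is \<open>2 * e * e'\<close> with
    \<open>e'\<close> at most \<open>2 * \<bar>L\<bar>\<close> times the sum of the absolute
    defects, and Cauchy-Schwarz bounds the square of that sum by
    \<open>card ?A * E u\<close>.\<close>
  proof (rule gronwall_zero[where E = E and E' = E' and C = "4 * \<bar>L\<bar> * card ?A"])
    fix u assume u: "u \<in> ?S"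
    then show "(E has_real_derivative E' u) (at u)" using dE ST by blast
    let ?s = "\<Sum>(i, b)\<in>?A. \<bar>e i b u\<bar>"
    have key: "2 * \<bar>e j a u\<bar> * \<bar>e' j a u\<bar> \<le> 2 * \<bar>e j a u\<bar> * (2 * (\<bar>L\<bar> * ?s))"
      if "a < k" for j a
    proof -
      have "\<bar>e' j a u\<bar> \<le> 2 * (L * ?s)" using e'_le u that by blast
      also have "\<dots> \<le> 2 * (\<bar>L\<bar> * ?s)"
        by (intro mult_left_mono mult_right_mono) (auto intro: sum_nonneg)
      finally show ?thesis by (intro mult_left_mono) auto
    qed
    have "\<bar>E' u\<bar> \<le> (\<Sum>(j, a)\<in>?A. 2 * \<bar>e j a u\<bar> * \<bar>e' j a u\<bar>)"
      unfolding E'_def by (rule order_trans[OF sum_abs]) (simp add: case_prod_unfold abs_mult)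
    also have "\<dots> \<le> (\<Sum>(j, a)\<in>?A. 2 * \<bar>e j a u\<bar> * (2 * (\<bar>L\<bar> * ?s)))"
      unfolding case_prod_unfold using key by (intro sum_mono) (auto simp: case_prod_unfold)
    also have "\<dots> = 2 * ?s * (2 * (\<bar>L\<bar> * ?s))"
      unfolding case_prod_unfold sum_distrib_left[of 2] sum_distrib_right ..
    also have "\<dots> = 4 * \<bar>L\<bar> * ?s\<^sup>2"
      by (simp only: power2_eq_square mult_ac)
    also have "\<dots> \<le> 4 * \<bar>L\<bar> * (E u * card ?A)"
      using sum_squared_le_sum_of_squares[of "\<lambda>(i, b). \<bar>e i b u\<bar>" ?A]
      by (intro mult_left_mono) (simp_all add: E_def case_prod_unfold)
    finally show "\<bar>E' u\<bar> \<le> 4 * \<bar>L\<bar> * card ?A * E u" by (simp add: mult_ac)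
  next
    show "E 0 = 0"
    proof -
      have "(x 0 $ j) a = s j * (x 0 $ \<rho> j) a" for j a
        using hyp by blast
      then have "e j a 0 = 0" for j a
        unfolding e_def right_minus_eq by blast
      then show ?thesis by (simp add: E_def)
    qed
  qed
  then have "(\<Sum>p\<in>?A. (e (fst p) (snd p) t)\<^sup>2) = 0"
    by (intro antisym sum_nonneg) (simp_all add: E_def case_prod_unfold)
  then have et: "e j a t = 0" if "a < k" for j a
    using that by (subst (asm) sum_nonneg_eq_0_iff) auto
  have "(x t $ j) a = s j * (x t $ \<rho> j) a" for j a
  proof (cases "a < k")
    case True
    then show ?thesis using et unfolding e_def right_minus_eq by blast
  next
    case False
    then show ?thesis
      using Rn[OF \<open>t \<in> T\<close>, of j] Rn[OF \<open>t \<in> T\<close>, of "\<rho> j"] by (simp add: coord_space_def)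
  qed
  then show "x t \<in> {x. (\<forall>j. x $ j \<in> Rn k) \<and> (\<forall>j a. (x $ j) a = s j * (x $ \<rho> j) a)}"
    using Rn[OF \<open>t \<in> T\<close>] by blast
qed

section \<open>Even-odd fields are tangent to the polydiagonal\<close>

lemma even_odd_field_tangent:
  fixes W :: "real^'n^'n::finite" and s :: "'n \<Rightarrow> real"
  assumes s: "\<And>j. s j \<in> {-1, 0, 1}"
    and W: "\<And>y :: real^'n. (\<And>j. y $ j = s j * y $ \<rho> j) \<Longrightarrow> (W *v y) $ j = s j * (W *v y) $ \<rho> j"
    and g: "\<And>u. u \<in> Rn k \<Longrightarrow> g (- u) = - g u"
    and h: "\<And>u v. u \<in> Rn k \<Longrightarrow> v \<in> Rn k \<Longrightarrow> h (- u) v = h u v \<and> h u (- v) = - h u v"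
    and x: "\<And>i. x $ i \<in> Rn k" "\<And>i b. (x $ i) b = s i * (x $ \<rho> i) b"
  shows "(additive_field W g h x $ j) a = s j * (additive_field W g h x $ \<rho> j) a"
proof -
  have zero: "(0 :: nat \<Rightarrow> real) \<in> Rn k" by (simp add: coord_space_def)
  \<comment> \<open>Odd maps vanish at the origin; this settles \<open>g\<close> on the zero part
    and makes the inputs from zero-part cells vanish.\<close>
  have g0: "g 0 a = 0" using g[OF zero] by (auto simp: fun_eq_iff dest: spec[of _ a])
  have h0: "h u 0 a = 0" if "u \<in> Rn k" for u
    using h[OF that zero] by (auto simp: fun_eq_iff dest: spec[of _ a])
  have sx: "s i = 1 \<and> x $ i = x $ \<rho> i \<or> s i = -1 \<and> x $ i = - (x $ \<rho> i) \<or> s i = 0 \<and> x $ i = 0"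
    for i using s[of i] x(2)[of i] by (auto simp: fun_eq_iff)
  \<comment> \<open>The inputs to cell \<open>j\<close> with the component \<open>a\<close> fixed
    form a real vector, to which the hypothesis on \<open>W\<close> applies.\<close>
  define y :: "real^'n" where "y = (\<chi> i. h (x $ j) (x $ i) a)"
  have "y $ i = s i * y $ \<rho> i" for i
    using sx[of i] h[OF x(1)[of j] x(1)[of "\<rho> i"]] h0[OF x(1)[of j]] by (auto simp: y_def)
  from W[OF this] have Wy: "(W *v y) $ j = s j * (W *v y) $ \<rho> j" .
  have field: "(additive_field W g h x $ i) a = g (x $ i) a + (W *v (\<chi> l. h (x $ i) (x $ l) a)) $ i"
    for i by (simp add: additive_field_def matrix_vector_mult_def)
  show ?thesis
    using sx[of j]
  proof (elim disjE conjE)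
    \<comment> \<open>Evenness in the first argument makes \<open>\<rho> j\<close> receive the same
      input vector \<open>y\<close> as \<open>j\<close>, so the sign change of the coupling comes
      from \<open>W *v y\<close> alone and that of the internal term from oddness of
      \<open>g\<close>.\<close>
    assume "s j = -1" and xj: "x $ j = - (x $ \<rho> j)"
    moreover have "y = (\<chi> l. h (x $ \<rho> j) (x $ l) a)"
      using h[OF x(1)[of "\<rho> j"] x(1)] by (simp add: y_def xj)
    ultimately show ?thesis
      using Wy g[OF x(1)[of "\<rho> j"]] unfolding field y_def[symmetric] by simp
  next
    assume "s j = 1" and xj: "x $ j = x $ \<rho> j"
    then show ?thesis using Wy by (simp add: field y_def)
  next
    \<comment> \<open>The single inputs \<open>h 0 (x $ i)\<close> may be nonzero; it is their
      weighted sum that vanishes, by the hypothesis on \<open>W\<close>.\<close>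
    assume "s j = 0" and "x $ j = 0"
    then show ?thesis using Wy g0 by (simp add: field y_def)
  qed
qed

section \<open>The linear test system\<close>

text \<open>The solution is \<open>exp (t W) y\<close>, written as one real power series per cell.
  The operator norm \<open>K\<close> of \<open>W\<close> dominates it by the series of
  \<open>exp (K * \<bar>t\<bar>)\<close>, so it converges for all \<open>t\<close> and may be
  differentiated term by term.\<close>

lemma linear_ode_solution:
  fixes W :: "real^'n^'n::finite" and y :: "real^'n"
  obtains x :: "real \<Rightarrow> real^'n"
  where "x 0 = y" "\<And>t j. ((\<lambda>u. x u $ j) has_real_derivative (W *v x t) $ j) (at t)"
proof -
  define u where "u m = ((*v) W ^^ m) y" for m
  define c where "c j m = u m $ j / fact m" for j m
  define K where "K = onorm ((*v) W)"
  have K: "norm (W *v v) \<le> K * norm v" for v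
    unfolding K_def by (rule onorm[OF matrix_vector_mul_bounded_linear])
  have "0 \<le> K" unfolding K_def by (rule onorm_pos_le[OF matrix_vector_mul_bounded_linear])
  have u: "norm (u m) \<le> K ^ m * norm y" for m
  proof (induction m)
    case (Suc m)
    have "norm (u (Suc m)) \<le> K * norm (u m)" by (simp add: u_def K)
    also have "\<dots> \<le> K * (K ^ m * norm y)" by (intro mult_left_mono Suc.IH \<open>0 \<le> K\<close>)
    finally show ?case by simp
  qed (simp add: u_def)
  have summ: "summable (\<lambda>m. c j m * t ^ m)" for j t
  proof (rule summable_comparison_test'[OF summable_mult[OF summable_exp]])
    fix m :: nat
    have "\<bar>u m $ j\<bar> \<le> K ^ m * norm y" using component_le_norm_cart u order_trans by blast
    then have "\<bar>u m $ j\<bar> * \<bar>t\<bar> ^ m / fact m \<le> K ^ m * norm y * \<bar>t\<bar> ^ m / fact m"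
      by (intro divide_right_mono mult_right_mono) auto
    then show "norm (c j m * t ^ m) \<le> norm y * (inverse (fact m) * (K * \<bar>t\<bar>) ^ m)"
      by (simp add: c_def abs_mult power_abs field_simps)
  qed
  \<comment> \<open>The factor \<open>Suc m\<close> in \<open>diffs\<close> cancels against
    \<open>fact (Suc m)\<close>, leaving one more application of \<open>W\<close> over
    \<open>fact m\<close>.\<close>
  have diffs: "diffs (c j) m = (\<Sum>i\<in>UNIV. W $ j $ i * c i m)" for j m
  proof -
    have "diffs (c j) m = u (Suc m) $ j / fact m"
      by (simp add: diffs_def c_def del: of_nat_Suc)
    then show ?thesis
      by (simp add: u_def c_def matrix_vector_mult_def sum_divide_distrib)
  qed
  show thesis
  proof (rule that[of "\<lambda>t. \<chi> j. \<Sum>m. c j m * t ^ m"])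
    have "(\<Sum>m. c j m * 0 ^ m) = y $ j" for j
      using powser_zero[of "c j"] by (simp add: c_def u_def)
    then show "(\<chi> j. \<Sum>m. c j m * 0 ^ m) = y" by (simp add: vec_eq_iff)
    fix t j
    have "(\<Sum>m. diffs (c j) m * t ^ m) = (\<Sum>m. \<Sum>i\<in>UNIV. W $ j $ i * (c i m * t ^ m))"
      by (simp add: diffs sum_distrib_right mult.assoc)
    also have "\<dots> = (\<Sum>i\<in>UNIV. W $ j $ i * (\<Sum>m. c i m * t ^ m))"
      by (subst suminf_sum) (simp_all add: suminf_mult summ summable_mult)
    finally show "((\<lambda>u. (\<chi> j. \<Sum>m. c j m * u ^ m) $ j) has_real_derivative
        (W *v (\<chi> j. \<Sum>m. c j m * t ^ m)) $ j) (at t)"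
      using termdiffs_strong_converges_everywhere[OF summ, of j t]
      by (simp add: matrix_vector_mult_def)
  qed
qed

lemma C_diff_const: "C_diff m I (\<lambda>_. c)"
proof (induction m arbitrary: c)
  case (Suc m)
  then show ?case by (auto intro!: exI[of _ "\<lambda>_ _. 0"])
qed simp

lemma C_diff_coordinate: "C_diff m I (\<lambda>z. z i)"
proof -
  have cont: "continuous_on (coord_space I) (\<lambda>z. z i)"
    by (rule continuous_on_subset[OF continuous_on_product_coordinates]) simp
  have "((\<lambda>t. (x(l := t)) i) has_real_derivative (if l = i then 1 else 0)) (at (x l))"
    for x :: "'a \<Rightarrow> real" and l
    by (cases "l = i") auto
  then show ?thesis
    using cont C_diff_const
    by (cases m) (auto intro!: exI[of _ "\<lambda>l _. if l = i then 1 else 0"])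
qed

text \<open>The coupling ignores its first argument, hence is even in it, and is linear, hence odd,
  in the second.\<close>

lemma linear_system_even_odd:
  "additive_field W (\<lambda>_. 0) (\<lambda>_ v. v) \<in> even_odd_systems k W"
proof -
  have "smooth_map1 k (\<lambda>_. 0)"
    by (simp add: smooth_map1_def smooth_def C_diff_const coord_space_def)
  moreover have "smooth_map2 k (\<lambda>_ v. v)"
    by (simp add: smooth_map2_def smooth_def C_diff_coordinate)
  ultimately show ?thesis
    unfolding even_odd_systems_def
    by (intro CollectI exI[of _ "\<lambda>_. 0"] exI[of _ "\<lambda>_ v. v"] conjI refl) simp_all
qed

section \<open>The two implications\<close>

theorem proposition10p1:
  fixes W :: "real^'n^'n::finite"
    and P :: "part_label \<Rightarrow> 'n set"
    and p q r :: nat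
  assumes "tagged_partition p q r P"
    and "\<not> standard p q r"
  shows "even_odd_balanced W p q r P \<longleftrightarrow>
    (\<forall>k\<ge>1. \<forall>f\<in>even_odd_systems k W. flow_invariant k f (polydiagonal (Rn k) p q r P))"
proof -
  obtain s \<rho> where s: "\<And>j. s j \<in> {-1, 0, 1 :: real}"
      "\<And>j. s j \<noteq> 0 \<Longrightarrow> s (\<rho> j) = 1 \<and> \<rho> (\<rho> j) = \<rho> j"
    and real_poly: "\<And>x :: real^'n. x \<in> polydiagonal UNIV p q r P \<longleftrightarrow> (\<forall>j. x $ j = s j * x $ \<rho> j)"
    using polydiagonal_sign_form[OF assms(1)] by blast
  \<comment> \<open>The real sign form, applied to each coordinate, gives the set in the shape
    required by the invariance lemma.\<close>
  have poly: "polydiagonal (Rn k) p q r P =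
      {x. (\<forall>j. x $ j \<in> Rn k) \<and> (\<forall>j a. (x $ j) a = s j * (x $ \<rho> j) a)}" for k
    by (intro set_eqI)
      (unfold polydiagonal_componentwise[of _ "Rn k"] real_poly vec_lambda_beta mem_Collect_eq, blast)
  have balanced: "even_odd_balanced W p q r P \<longleftrightarrow>
      (\<forall>y :: real^'n. (\<forall>j. y $ j = s j * y $ \<rho> j) \<longrightarrow> (\<forall>j. (W *v y) $ j = s j * (W *v y) $ \<rho> j))"
    unfolding even_odd_balanced_def image_subset_iff Ball_def real_poly ..
  show ?thesis
  proof (intro iffI allI impI ballI)
    fix k :: nat and f
    assume bal: "even_odd_balanced W p q r P" and "f \<in> even_odd_systems k W"
    then obtain g h where f: "f = additive_field W g h" and g: "smooth_map1 k g"
      and h: "smooth_map2 k h" and g_odd: "\<And>u. u \<in> Rn k \<Longrightarrow> g (- u) = - g u"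
      and h_eo: "\<And>u v. u \<in> Rn k \<Longrightarrow> v \<in> Rn k \<Longrightarrow> h (- u) v = h u v \<and> h u (- v) = - h u v"
      unfolding even_odd_systems_def by blast
    have W: "(W *v y) $ j = s j * (W *v y) $ \<rho> j" if "\<And>j. y $ j = s j * y $ \<rho> j" for y j
      using bal that unfolding balanced by blast
    show "flow_invariant k f (polydiagonal (Rn k) p q r P)"
      unfolding poly f
    proof (rule flow_invariant_if_tangent[OF s additive_field_lipschitz_on_box[OF g h]])
      fix x :: "(nat \<Rightarrow> real)^'n" and j a
      assume x: "\<And>i. x $ i \<in> Rn k" "\<And>i b. (x $ i) b = s i * (x $ \<rho> i) b"
      show "(additive_field W g h x $ j) a = s j * (additive_field W g h x $ \<rho> j) a"
        using s(1) W g_odd h_eo x by (rule even_odd_field_tangent)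
    qed
  next
    let ?F = "additive_field W (\<lambda>_. 0) (\<lambda>_ v. v)"
    assume inv: "\<forall>k\<ge>1. \<forall>f\<in>even_odd_systems k W.
      flow_invariant k f (polydiagonal (Rn k) p q r P)"
    have "(W *v y) $ j = s j * (W *v y) $ \<rho> j" if y: "\<forall>j. y $ j = s j * y $ \<rho> j" for y j
    proof -
      obtain x where x0: "x 0 = y"
        and x: "\<And>t j. ((\<lambda>u. x u $ j) has_real_derivative (W *v x t) $ j) (at t)"
        using linear_ode_solution[of y W] by blast
      \<comment> \<open>The real solution as a solution with cell phase space \<open>Rn 1\<close>:
        coordinate \<open>0\<close> carries it and all others vanish. It is defined for all times,
        so invariance is used with the interval \<open>UNIV\<close>.\<close>
      define X :: "real \<Rightarrow> (nat \<Rightarrow> real)^'n" where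
        "X t = (\<chi> j. (\<lambda>a. if a = 0 then x t $ j else 0))" for t
      have "solution_on 1 ?F UNIV X"
        using x by (auto simp: solution_on_def X_def coord_space_def additive_field_def
            matrix_vector_mult_def)
      moreover have "X 0 \<in> polydiagonal (Rn 1) p q r P"
        unfolding poly by (simp add: X_def coord_space_def x0) (use y in blast)
      ultimately have X: "X t \<in> polydiagonal (Rn 1) p q r P" for t
        using inv linear_system_even_odd[of W 1] is_interval_univ open_UNIV
        unfolding flow_invariant_def by blast
      have "x t $ j = s j * x t $ \<rho> j" for t
      proof -
        have "(X t $ j) 0 = s j * (X t $ \<rho> j) 0"
          using X[of t] unfolding poly by blast
        then show ?thesis by (simp add: X_def)
      qed
      \<comment> \<open>By invariance, \<open>x t $ j\<close> and
        \<open>s j * x t $ \<rho> j\<close> are the same function of \<open>t\<close>; uniqueness of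
        its derivative at \<open>0\<close>, where \<open>x 0 = y\<close>, gives the claim for
        \<open>W *v y\<close>.\<close>
      then have "((\<lambda>u. x u $ j) has_real_derivative s j * (W *v x 0) $ \<rho> j) (at 0)"
        using DERIV_cmult[OF x] by presburger
      then show ?thesis
        using DERIV_unique x x0 by blast
    qed
    then show "even_odd_balanced W p q r P"
      unfolding balanced by blast
  qed
qed

end
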